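(* Let $q$ be an odd prime power such that $q\equiv1\pmod 4$ and let $\gamma\in\mathbb{F}_{q^2}$. The polynomial $f(x)=x+\gamma\,\mathrm{Tr}\left(x^{q+3}\right)$ over $\mathbb{F}_{q^2}$ is a permutation polynomial if and only if $\gamma=0$.
   Context: $\mathrm{Tr}:\mathbb{F}_{q^2}\to\mathbb{F}_q$ is the trace map $\mathrm{Tr}(x)=x+x^q$. A polynomial $f$ over $\mathbb{F}_{q^2}$ is a permutation polynomial if the map $x\mapsto f(x)$ is a bijection of $\mathbb{F}_{q^2}$ onto itself. *)

theory Defs
  imports
    "HOL-Library.Cardinality"
    "HOL-Computational_Algebra.Polynomial"
    "HOL-Computational_Algebra.Primes"
    "HOL-Number_Theory.Prime_Powers"
begin

text \<open>
  The trace of a field with \<open>q\<^sup>2\<close> elements over its subfield with \<open>q\<close> elements. The type is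
  general enough for the same formula to be applied to a polynomial over that field, as in the
  expression \<open>Tr(X\<^bsup>q+3\<^esup>)\<close>; the lemma \<open>poly_rel_trace\<close> relates the two uses.
\<close>

definition rel_trace :: "nat \<Rightarrow> 'a::comm_semiring_1 \<Rightarrow> 'a" where
  "rel_trace q x = x + x ^ q"

lemma poly_rel_trace: "poly (rel_trace q p) x = rel_trace q (poly p x)"
  by (simp add: rel_trace_def)

definition permutation_poly :: "'a::finite_field poly \<Rightarrow> bool" where
  "permutation_poly f \<longleftrightarrow> bij (poly f)"

end

theory Submission
  imports Defs "HOL-Analysis.Convex"
begin

text \<open>
  Write \<open>K\<close> for the subfield with \<open>q\<close> elements and \<open>\<gamma> = u + w\<close> with \<open>u\<^sup>q = u\<close>, \<open>w\<^sup>q = -w\<close>. For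
  \<open>c, d \<in> K\<close> the element \<open>x = cu + dw\<close> has \<open>Tr(x\<^bsup>q+3\<^esup>) = 2(c\<^sup>4 u\<^sup>4 - d\<^sup>4 w\<^sup>4)\<close>, where
  \<open>u\<^sup>4, w\<^sup>4 \<in> K\<close>. Comparing the points with coordinates \<open>(a + t, b + t)\<close> and \<open>(a - t, b - t)\<close>, a collision
  of \<open>f\<close> amounts to a solution with \<open>t \<noteq> 0\<close> of
  \<open>u\<^sup>4 a(a\<^sup>2 + t\<^sup>2) - w\<^sup>4 b(b\<^sup>2 + t\<^sup>2) = -1/8\<close> in \<open>K\<close>. Because -1 is a square in \<open>K\<close>, we have
  \<open>u\<^sup>4 \<noteq> w\<^sup>4\<close> when \<open>\<gamma> \<noteq> 0\<close>, and the surface has rational points at infinity: if \<open>uw \<noteq> 0\<close>, some lines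
  through such a point meet the surface in exactly one further point. If \<open>uw = 0\<close> the surface is a
  cylinder over a cubic curve of the form \<open>rs(r + s) = const\<close>, on which a point is found by
  counting. Both arguments are needed only when not every element of \<open>K\<close> is a cube.
\<close>

section \<open>Counting roots and fibres\<close>

lemma finite_power_roots:
  fixes c :: "'a::field"
  assumes "n > 0"
  shows "finite {x. x ^ n = c}" and "card {x. x ^ n = c} \<le> n"
proof -
  let ?p = "monom 1 n - [:c:]"
  have deg: "degree ?p = n"
    using assms by (subst diff_conv_add_uminus, subst degree_add_eq_left) (auto simp: degree_monom_eq)
  then have nz: "?p \<noteq> 0"
    using assms by auto
  have roots: "{x. poly ?p x = 0} = {x. x ^ n = c}"
    by (simp add: poly_monom)
  show "finite {x. x ^ n = c}"
    using poly_roots_finite[OF nz] unfolding roots .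
  show "card {x. x ^ n = c} \<le> n"
    using card_poly_roots_bound[OF nz] unfolding roots deg .
qed

lemma card_le_if_power_roots:
  fixes c :: "'a::field"
  assumes "n > 0" and "A \<subseteq> {x. x ^ n = c}"
  shows "card A \<le> n"
  using card_mono[OF finite_power_roots(1)[OF assms(1)] assms(2)] finite_power_roots(2)[OF assms(1), of c]
  by (rule le_trans)

lemma card_le_fibre_bound:
  assumes "finite A" and "\<And>y. card {x \<in> A. f x = y} \<le> m"
  shows "card A \<le> m * card (f ` A)"
proof -
  have "A = (\<Union>y\<in>f ` A. {x \<in> A. f x = y})"
    by auto
  then have "card A \<le> (\<Sum>y\<in>f ` A. card {x \<in> A. f x = y})"
    using card_UN_le[of "f ` A" "\<lambda>y. {x \<in> A. f x = y}"] assms(1) by simp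
  also have "\<dots> \<le> (\<Sum>y\<in>f ` A. m)"
    by (intro sum_mono assms(2))
  finally show ?thesis
    by (simp add: mult.commute)
qed

text \<open>Cauchy-Schwarz for the fibre sizes: they sum to \<open>card A\<close>, and their squares
  sum to the number of colliding pairs.\<close>

lemma card_power2_le_card_collisions:
  assumes "finite A"
  shows "(card A)\<^sup>2 \<le> card {(x, y). x \<in> A \<and> y \<in> A \<and> f x = f y} * card (f ` A)"
proof -
  define F where "F v = {x \<in> A. f x = v}" for v
  have fin: "finite (F v)" for v
    using assms by (auto simp: F_def)
  have "A = (\<Union>v\<in>f ` A. F v)"
    by (auto simp: F_def)
  then have "card A = card (\<Union>v\<in>f ` A. F v)"
    by simp
  also have "\<dots> = (\<Sum>v\<in>f ` A. card (F v))"
    using assms fin by (intro card_UN_disjoint) (auto simp: F_def)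
  finally have A: "card A = (\<Sum>v\<in>f ` A. card (F v))" .
  have "{(x, y). x \<in> A \<and> y \<in> A \<and> f x = f y} = (\<Union>v\<in>f ` A. F v \<times> F v)"
    by (auto simp: F_def)
  then have "card {(x, y). x \<in> A \<and> y \<in> A \<and> f x = f y} = card (\<Union>v\<in>f ` A. F v \<times> F v)"
    by simp
  also have "\<dots> = (\<Sum>v\<in>f ` A. card (F v \<times> F v))"
    using assms fin by (intro card_UN_disjoint) (auto simp: F_def)
  finally have E: "card {(x, y). x \<in> A \<and> y \<in> A \<and> f x = f y} = (\<Sum>v\<in>f ` A. (card (F v))\<^sup>2)"
    by (simp add: card_cartesian_product power2_eq_square)
  have "real ((card A)\<^sup>2) \<le> real ((\<Sum>v\<in>f ` A. (card (F v))\<^sup>2) * card (f ` A))"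
    using sum_squared_le_sum_of_squares[of "\<lambda>v. real (card (F v))" "f ` A"] by (simp add: A)
  then show ?thesis
    unfolding E by linarith
qed

section \<open>Arithmetic of the subfield \<open>K\<close>\<close>

locale char_power_subfield =
  fixes K :: "'a::field_prime_char set" and q k :: nat
  assumes K_eq: "K = {x. x ^ q = x}"
    and q_eq: "q = CHAR('a) ^ k"
    and q_mod_4: "q mod 4 = 1"
    and card_K: "card K = q"
begin

lemma odd_q: "odd q"
  using q_mod_4 by presburger

lemma finite_K: "finite K"
  using card_K odd_q by (intro card_ge_0_finite) (auto elim: oddE)

lemma K_0: "0 \<in> K"
  using odd_q by (auto simp: K_eq elim: oddE)

lemma K_1: "1 \<in> K"
  by (simp add: K_eq)

lemma q_ge_5: "q \<ge> 5"
proof -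
  have "card {0, 1 :: 'a} \<le> q"
    unfolding card_K[symmetric] using finite_K K_0 K_1 by (intro card_mono) auto
  then have "q \<ge> 2"
    by simp
  with q_mod_4 show ?thesis
    by presburger
qed

lemma K_add: "x \<in> K \<Longrightarrow> y \<in> K \<Longrightarrow> x + y \<in> K"
  using freshmans_dream'[OF CHAR_prime q_eq, of x y] by (simp add: K_eq)

lemma K_uminus: "x \<in> K \<Longrightarrow> - x \<in> K"
  using odd_q by (simp add: K_eq)

lemma K_diff: "x \<in> K \<Longrightarrow> y \<in> K \<Longrightarrow> x - y \<in> K"
  using K_add[of x "- y"] K_uminus[of y] by simp

lemma K_mult: "x \<in> K \<Longrightarrow> y \<in> K \<Longrightarrow> x * y \<in> K"
  by (simp add: K_eq power_mult_distrib)

lemma K_divide: "x \<in> K \<Longrightarrow> y \<in> K \<Longrightarrow> x / y \<in> K"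
  by (simp add: K_eq power_divide)

lemma K_power: "x \<in> K \<Longrightarrow> x ^ n \<in> K"
  by (induction n) (auto intro: K_1 K_mult)

lemma K_of_nat: "of_nat n \<in> K"
  by (induction n) (auto intro: K_0 K_1 K_add)

lemma K_numeral: "numeral n \<in> K"
  using K_of_nat[of "numeral n"] by simp

lemmas K_closed = K_0 K_1 K_add K_uminus K_diff K_mult K_divide K_power K_numeral

lemma power_pred_q: "x \<in> K \<Longrightarrow> x \<noteq> 0 \<Longrightarrow> x ^ (q - 1) = 1"
  using q_ge_5 power_Suc[of x "q - 1"] by (simp add: K_eq)

lemma prime_neq_0:
  assumes "prime p" and "\<not> p dvd q"
  shows "of_nat p \<noteq> (0 :: 'a)"
proof
  assume "of_nat p = (0 :: 'a)"
  then have "CHAR('a) = p"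
    using assms(1) CHAR_prime[where 'a = 'a] primes_dvd_imp_eq by (auto simp: of_nat_eq_0_iff_char_dvd)
  moreover have "k \<noteq> 0"
    using q_eq q_ge_5 by (intro notI) simp
  ultimately show False
    using assms(2) q_eq by simp
qed

lemma two_neq_0: "(2 :: 'a) \<noteq> 0"
  using prime_neq_0[of 2] odd_q by simp

lemma four_neq_0: "(4 :: 'a) \<noteq> 0"
  using two_neq_0 mult_eq_0_iff[of "2::'a" 2] by simp

lemma three_neq_0:
  assumes "q mod 3 = 1"
  shows "(3 :: 'a) \<noteq> 0"
  using prime_neq_0[of 3] assms by (simp add: dvd_eq_mod_eq_0)

text \<open>By root counting, some nonzero \<open>x\<close> has
  \<open>x ^ (2 * m) \<noteq> 1\<close>, where \<open>q = 4 * m + 1\<close>. This power squares to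
  1, so it is -1, and \<open>x ^ m\<close> is the root.\<close>

lemma sqrt_minus_one: obtains i where "i \<in> K" and "i\<^sup>2 = -1"
proof -
  obtain m where q: "q = 4 * m + 1"
    using q_mod_4 by (metis mult_div_mod_eq)
  have m: "m > 0"
    using q q_ge_5 by simp
  have "\<exists>x\<in>K - {0}. x ^ (2 * m) \<noteq> 1"
  proof (rule ccontr)
    assume "\<not> ?thesis"
    then have "K - {0} \<subseteq> {x. x ^ (2 * m) = 1}"
      by auto
    then have "card (K - {0}) \<le> 2 * m"
      using m by (intro card_le_if_power_roots) auto
    then show False
      using K_0 card_K finite_K q m by simp
  qed
  then obtain x where x: "x \<in> K" "x \<noteq> 0" "x ^ (2 * m) \<noteq> 1"
    by auto
  have "(x ^ (2 * m))\<^sup>2 = 1"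
    using power_pred_q[OF x(1,2)] by (simp add: q flip: power_mult)
  then have "x ^ (2 * m) = -1"
    using x(3) by (simp add: power2_eq_1_iff)
  then have "(x ^ m)\<^sup>2 = -1"
    by (metis mult.commute power_mult)
  then show ?thesis
    using that K_power[OF x(1)] by blast
qed

section \<open>Cubes in \<open>K\<close>\<close>

text \<open>A power map inverts cubing: the exponent is \<open>q div 3\<close> if 3 divides
  \<open>q\<close>, and (2q - 1)/3 otherwise.\<close>

lemma cube_root_exists:
  assumes "q mod 3 \<noteq> 1" and x: "x \<in> K"
  shows "\<exists>y\<in>K. y ^ 3 = x"
proof -
  have xq: "x ^ q = x"
    using x by (simp add: K_eq)
  have "q mod 3 = 0 \<or> q mod 3 = 2"
    using assms(1) by presburger
  then show ?thesis
  proof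
    assume "q mod 3 = 0"
    then have "q div 3 * 3 = q"
      by presburger
    then have "(x ^ (q div 3)) ^ 3 = x"
      using xq by (simp flip: power_mult)
    then show ?thesis
      using K_power[OF x] by blast
  next
    assume "q mod 3 = 2"
    then have q: "(2 * (q div 3) + 1) * 3 = q + (q - 1)"
      by presburger
    have "(x ^ (2 * (q div 3) + 1)) ^ 3 = x ^ (q + (q - 1))"
      by (simp only: q flip: power_mult)
    also have "\<dots> = x"
      using xq power_pred_q[OF x] by (cases "x = 0") (auto simp: power_add)
    finally show ?thesis
      using K_power[OF x] by blast
  qed
qed

text \<open>Cubing is at most 3-to-1 on the 3n nonzero elements, so there are at least n nonzero
  cubes, all among the at most n roots of \<open>y ^ n = 1\<close>.\<close>

lemma cubic_residue:
  assumes q: "q = 3 * n + 1" and y: "y \<in> K" "y ^ n = 1"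
  shows "\<exists>x\<in>K. x ^ 3 = y"
proof -
  let ?C = "(\<lambda>x. x ^ 3) ` (K - {0})" and ?H = "{y. y ^ n = (1 :: 'a)}"
  have n: "n > 0"
    using q q_ge_5 by simp
  have sub: "?C \<subseteq> ?H"
    using power_pred_q by (auto simp: q power_mult)
  have "card {x \<in> K - {0}. x ^ 3 = z} \<le> 3" for z
    by (intro card_le_if_power_roots[of _ _ z]) auto
  then have "card (K - {0}) \<le> 3 * card ?C"
    using finite_K by (intro card_le_fibre_bound) auto
  then have "n \<le> card ?C"
    using K_0 card_K finite_K q by simp
  then have "?C = ?H"
    using finite_power_roots[OF n, of "1::'a"] sub by (intro card_seteq) auto
  then have "y \<in> ?C"
    using y(2) by blast
  then show ?thesis
    by blast
qed

text \<open>
  Second moment argument: if the values \<open>r(r+1)\<close> missed one of the three cosets of the cubes, then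
  too many pairs \<open>(r, s)\<close> would have \<open>r(r+1)\<close> and \<open>s(s+1)\<close> in the same coset. An off-diagonal pair is
  determined by \<open>\<rho> = r/s\<close> and \<open>y = r(r+1)/s(s+1)\<close>, because \<open>s (\<rho>\<^sup>2 - y) = y - \<rho>\<close>.
\<close>

lemma consecutive_product_coset:
  assumes q: "q = 3 * n + 1" and c: "c \<in> K" "c \<noteq> 0"
  shows "\<exists>r\<in>K. r \<noteq> 0 \<and> r \<noteq> -1 \<and> (r * (r + 1)) ^ n = c ^ n"
proof (rule ccontr)
  assume contra: "\<not> ?thesis"
  define X where "X = K - {0, -1}"
  define \<phi> where "\<phi> r = (r * (r + 1)) ^ n" for r :: 'a
  define H where "H = {y. y ^ n = (1 :: 'a)}"
  define E where "E = {(r, s). r \<in> X \<and> s \<in> X \<and> \<phi> r = \<phi> s}"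
  have n: "n > 0"
    using q q_ge_5 by simp
  have finX: "finite X"
    using finite_K by (simp add: X_def)
  have "card {0, -1 :: 'a} = 2"
    by simp
  then have cardX: "card X = q - 2"
    using K_0 K_uminus[OF K_1] finite_K card_K unfolding X_def by (subst card_Diff_subset) auto
  have X: "r \<in> K" "r \<noteq> 0" "r + 1 \<noteq> 0" if "r \<in> X" for r
    using that by (auto simp: X_def add_eq_0_iff2)
  \<comment> \<open>The cube root of unity \<open>x ^ n\<close> labels the coset of \<open>x\<close>
    modulo cubes; missing the label \<open>c ^ n\<close> leaves at most two values for
    \<open>\<phi>\<close>.\<close>
  have cube: "(x ^ n) ^ 3 = 1" if "x \<in> K" "x \<noteq> 0" for x
    using power_pred_q[OF that] by (simp add: q mult.commute flip: power_mult)
  have "\<phi> ` X \<subseteq> {w. w ^ 3 = 1} - {c ^ n}"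
  proof
    fix w assume "w \<in> \<phi> ` X"
    then obtain r where r: "r \<in> X" "w = \<phi> r"
      by auto
    then have "w ^ 3 = 1"
      unfolding r(2) \<phi>_def using X[OF r(1)] by (intro cube) (auto intro: K_closed)
    moreover have "w \<noteq> c ^ n"
      using contra r by (auto simp: \<phi>_def X_def)
    ultimately show "w \<in> {w. w ^ 3 = 1} - {c ^ n}"
      by simp
  qed
  then have "card (\<phi> ` X) \<le> card ({w. w ^ 3 = 1} - {c ^ n})"
    using finite_power_roots[of 3 "1::'a"] by (intro card_mono) auto
  also have "\<dots> \<le> 2"
    using finite_power_roots[of 3 "1::'a"] cube[OF c] by simp
  finally have two: "card (\<phi> ` X) \<le> 2" .
  have E: "E \<subseteq> (\<lambda>r. (r, r)) ` X \<union> {p \<in> E. fst p \<noteq> snd p}"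
    by (auto simp: E_def)
  have finE: "finite E"
    using finX by (rule_tac finite_subset[of _ "X \<times> X"]) (auto simp: E_def)
  define g where "g = (\<lambda>(r, s). (r * (r + 1) / (s * (s + 1)), r / s :: 'a))"
  have "inj_on g {p \<in> E. fst p \<noteq> snd p}"
  proof (rule inj_onI, clarsimp)
    fix r s r' s' assume in_E: "(r, s) \<in> E" "(r', s') \<in> E" and ne: "r \<noteq> s" "r' \<noteq> s'"
      and g: "g (r, s) = g (r', s')"
    define y \<rho> where "y = r * (r + 1) / (s * (s + 1))" and "\<rho> = r / s"
    have s: "s \<noteq> 0" "s' \<noteq> 0" and s1: "s + 1 \<noteq> 0" "s' + 1 \<noteq> 0"
      using in_E X by (auto simp: E_def)
    have y': "y = r' * (r' + 1) / (s' * (s' + 1))" and \<rho>': "\<rho> = r' / s'"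
      using g by (auto simp: g_def y_def \<rho>_def)
    have r: "r = \<rho> * s" "r' = \<rho> * s'"
      using s by (simp add: \<rho>_def) (use s in \<open>simp add: \<rho>'\<close>)
    have y: "r * (r + 1) = y * (s * (s + 1))" "r' * (r' + 1) = y * (s' * (s' + 1))"
      using s s1 by (simp add: y_def) (use s s1 in \<open>simp add: y'\<close>)
    have "s * (s * (\<rho>\<^sup>2 - y)) = s * (y - \<rho>)" "s' * (s' * (\<rho>\<^sup>2 - y)) = s' * (y - \<rho>)"
      using y unfolding r by (simp_all add: algebra_simps power2_eq_square)
    then have lin: "s * (\<rho>\<^sup>2 - y) = y - \<rho>" "s' * (\<rho>\<^sup>2 - y) = y - \<rho>"
      using s by simp_all
    \<comment> \<open>Equality would force \<open>\<rho>\<^sup>2 = y = \<rho>\<close>, so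
      \<open>\<rho> = 1\<close> and the pair would be diagonal.\<close>
    have "\<rho>\<^sup>2 \<noteq> y"
    proof
      assume "\<rho>\<^sup>2 = y"
      with lin have "\<rho> * \<rho> = \<rho> * 1"
        by (simp add: power2_eq_square)
      moreover have "\<rho> \<noteq> 0"
        using in_E X by (auto simp: E_def \<rho>_def)
      ultimately have "\<rho> = 1"
        by (simp only: mult_cancel_left) simp
      then show False
        using ne r by simp
    qed
    moreover have "(s - s') * (\<rho>\<^sup>2 - y) = 0"
      using lin by (simp add: left_diff_distrib)
    ultimately have "s = s'"
      by simp
    then show "r = r' \<and> s = s'"
      using r by simp
  qed
  moreover have "g ` {p \<in> E. fst p \<noteq> snd p} \<subseteq> H \<times> (K - {0, 1})"
    using X by (auto simp: E_def g_def H_def \<phi>_def power_divide intro: K_closed)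
  moreover have "finite (H \<times> (K - {0, 1}))"
    using finite_power_roots[OF n] finite_K by (auto simp: H_def)
  ultimately have "card {p \<in> E. fst p \<noteq> snd p} \<le> card (H \<times> (K - {0, 1}))"
    by (rule card_inj_on_le)
  also have "\<dots> \<le> n * (q - 2)"
  proof -
    have "card {0, 1 :: 'a} = 2"
      by simp
    then have "card (K - {0, 1}) = q - 2"
      using K_0 K_1 finite_K card_K by (subst card_Diff_subset) auto
    then show ?thesis
      using finite_power_roots(2)[OF n, of "1::'a"] by (simp add: card_cartesian_product H_def)
  qed
  finally have off: "card {p \<in> E. fst p \<noteq> snd p} \<le> n * (q - 2)" .
  have "card E \<le> card ((\<lambda>r. (r, r)) ` X) + card {p \<in> E. fst p \<noteq> snd p}"
    using card_mono[OF _ E] finX finE card_Un_le le_trans by fastforce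
  also have "\<dots> \<le> (q - 2) + n * (q - 2)"
    using card_image_le[OF finX, of "\<lambda>r. (r, r)"] off cardX by linarith
  finally have cardE: "card E \<le> (q - 2) + n * (q - 2)" .
  have "(q - 2)\<^sup>2 \<le> card E * card (\<phi> ` X)"
    using card_power2_le_card_collisions[OF finX, of \<phi>] unfolding cardX E_def .
  also have "\<dots> \<le> ((q - 2) + n * (q - 2)) * 2"
    by (rule mult_le_mono[OF cardE two])
  finally have "(q - 2) * (q - 2) \<le> (q - 2) * (2 * (n + 1))"
    by (simp add: power2_eq_square algebra_simps)
  then have "q - 2 \<le> 2 * (n + 1)"
    using q_ge_5 unfolding mult_le_cancel1 by simp
  \<comment> \<open>Here q - 2 = 3n - 1, which leaves only q = 4, 7, 10, none of them 1 modulo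
    4.\<close>
  then have "n \<le> 3"
    using q q_ge_5 by presburger
  then have "n = 1 \<or> n = 2 \<or> n = 3"
    using n by linarith
  then show False
    using q q_mod_4 by auto
qed

section \<open>Points on cubic curves and surfaces over \<open>K\<close>\<close>

text \<open>With r = u/v the form is \<open>v ^ 3 * (r * (r + 1))\<close>, so
  \<open>r * (r + 1) / c\<close> only has to be a nonzero cube. The condition
  \<open>u \<noteq> v\<close> later becomes \<open>t \<noteq> 0\<close>.\<close>

lemma binary_cubic_represents:
  assumes q3: "q mod 3 = 1" and c: "c \<in> K" "c \<noteq> 0"
  shows "\<exists>u\<in>K. \<exists>v\<in>K. u \<noteq> v \<and> u * v * (u + v) = c"
proof -
  obtain n where q: "q = 3 * n + 1"
    using q3 by (metis mult_div_mod_eq)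
  obtain r where r: "r \<in> K" "r \<noteq> 0" "r \<noteq> -1" "(r * (r + 1)) ^ n = c ^ n"
    using consecutive_product_coset[OF q c] by blast
  \<comment> \<open>\<open>r \<mapsto> -1 - r\<close> preserves \<open>r(r+1)\<close> and moves the forbidden value 1 to -2.\<close>
  define r' where "r' = (if r = 1 then -2 else r)"
  have r': "r' \<in> K" "r' \<noteq> 1" "r' * (r' + 1) = r * (r + 1)"
    using r three_neq_0[OF q3] by (auto simp: r'_def minus_equation_iff intro: K_closed)
  define y where "y = r' * (r' + 1) / c"
  have rn: "r * (r + 1) \<noteq> 0"
    using r by (simp add: add_eq_0_iff2)
  have "y \<in> K" "y ^ n = 1"
    using r r' c by (auto simp: y_def power_divide intro: K_closed)
  then obtain x where x: "x \<in> K" "x ^ 3 = y"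
    using cubic_residue[OF q] by blast
  have y0: "y \<noteq> 0"
    using rn c r' by (simp add: y_def)
  then have x0: "x \<noteq> 0"
    using x by auto
  have "(r' / x) * (1 / x) * (r' / x + 1 / x) = r' * (r' + 1) / x ^ 3"
    using x0 by (simp add: field_simps power3_eq_cube)
  also have "\<dots> = c"
    unfolding x(2) using y0 c(2) by (simp add: y_def)
  finally have "(r' / x) * (1 / x) * (r' / x + 1 / x) = c" .
  moreover have "r' / x \<noteq> 1 / x"
    using r' x0 by simp
  ultimately show ?thesis
    using r'(1) x(1) K_1 K_divide by blast
qed

text \<open>As -1 is a square, \<open>a\<^sup>2 + t\<^sup>2\<close> splits as \<open>u * v\<close>
  with u = a - it and v = a + it. Since u + v = 2a, the equation becomes
  \<open>u * v * (u + v) = 2 * c\<close>.\<close>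

lemma cubic_curve_point:
  assumes q3: "q mod 3 = 1" and c: "c \<in> K" "c \<noteq> 0"
  shows "\<exists>a\<in>K. \<exists>t\<in>K. t \<noteq> 0 \<and> a * (a\<^sup>2 + t\<^sup>2) = c"
proof -
  obtain i where i: "i \<in> K" "i\<^sup>2 = -1"
    by (rule sqrt_minus_one)
  obtain u v where uv: "u \<in> K" "v \<in> K" "u \<noteq> v" "u * v * (u + v) = 2 * c"
    using binary_cubic_represents[OF q3, of "2 * c"] c two_neq_0 K_closed by auto
  define a t where "a = (u + v) / 2" and "t = i * (u - v) / 2"
  have t0: "t \<noteq> 0"
    using uv i two_neq_0 by (auto simp: t_def)
  have at: "2 * a = u + v" "2 * t = i * (u - v)"
    by (simp_all only: a_def t_def times_divide_eq_right nonzero_mult_div_cancel_left[OF two_neq_0])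
  have "4 * (a\<^sup>2 + t\<^sup>2) = (2 * a)\<^sup>2 + (2 * t)\<^sup>2"
    by (simp add: power_mult_distrib distrib_left)
  also have "\<dots> = (u + v)\<^sup>2 + i\<^sup>2 * (u - v)\<^sup>2"
    unfolding at by (simp add: power_mult_distrib)
  also have "\<dots> = 4 * (u * v)"
    unfolding i(2) by (simp add: power2_eq_square algebra_simps)
  finally have "a\<^sup>2 + t\<^sup>2 = u * v"
    by (simp only: mult_left_cancel[OF four_neq_0])
  then have "a * (a\<^sup>2 + t\<^sup>2) = c"
    using uv(4) two_neq_0 by (simp add: a_def field_simps)
  moreover have "a \<in> K" "t \<in> K"
    using uv i by (auto simp: a_def t_def intro: K_closed)
  ultimately show ?thesis
    using t0 by blast
qed

lemma cubic_surface_point: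
  assumes \<alpha>: "\<alpha> \<in> K" and \<beta>: "\<beta> \<in> K" and \<kappa>: "\<kappa> \<in> K" and "\<alpha> \<noteq> \<beta>" and "\<kappa> \<noteq> 0"
  shows "\<exists>a\<in>K. \<exists>b\<in>K. \<exists>t\<in>K. t \<noteq> 0 \<and> \<alpha> * (a * (a\<^sup>2 + t\<^sup>2)) - \<beta> * (b * (b\<^sup>2 + t\<^sup>2)) = \<kappa>"
proof (cases "q mod 3 = 1")
  case False
  show ?thesis
  proof (cases "\<alpha> = 0")
    case nz: False
    \<comment> \<open>With \<open>a = t\<close> and \<open>b = 0\<close> the equation reads
      \<open>2 * \<alpha> * t ^ 3 = \<kappa>\<close>.\<close>
    then obtain t where t: "t \<in> K" "t ^ 3 = \<kappa> / (2 * \<alpha>)"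
      using cube_root_exists[OF False, of "\<kappa> / (2 * \<alpha>)"] \<alpha> \<kappa> by (auto intro: K_closed)
    have "\<alpha> * (t * (t\<^sup>2 + t\<^sup>2)) - \<beta> * (0 * (0\<^sup>2 + t\<^sup>2)) = 2 * \<alpha> * t ^ 3"
      by (simp add: power2_eq_square power3_eq_cube algebra_simps)
    also have "\<dots> = \<kappa>"
      unfolding t(2) using nz two_neq_0 by simp
    finally show ?thesis
      using t nz \<open>\<kappa> \<noteq> 0\<close> two_neq_0 K_0 by (intro bexI[of _ t] bexI[of _ 0]) auto
  next
    case True
    then have nz: "\<beta> \<noteq> 0"
      using \<open>\<alpha> \<noteq> \<beta>\<close> by simp
    then obtain t where t: "t \<in> K" "t ^ 3 = - \<kappa> / (2 * \<beta>)"
      using cube_root_exists[OF False, of "- \<kappa> / (2 * \<beta>)"] \<beta> \<kappa> by (auto intro: K_closed)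
    have "\<alpha> * (0 * (0\<^sup>2 + t\<^sup>2)) - \<beta> * (t * (t\<^sup>2 + t\<^sup>2)) = - (2 * \<beta> * t ^ 3)"
      by (simp add: power2_eq_square power3_eq_cube algebra_simps)
    also have "\<dots> = \<kappa>"
      unfolding t(2) using nz two_neq_0 by simp
    finally show ?thesis
      using t nz \<open>\<kappa> \<noteq> 0\<close> two_neq_0 K_0 by (intro bexI[of _ t] bexI[of _ 0]) auto
  qed
next
  case q3: True
  consider "\<alpha> = 0" "\<beta> \<noteq> 0" | "\<beta> = 0" "\<alpha> \<noteq> 0" | "\<alpha> \<noteq> 0" "\<beta> \<noteq> 0"
    using \<open>\<alpha> \<noteq> \<beta>\<close> by blast
  then show ?thesis
  proof cases
    case 1
    then obtain b t where "b \<in> K" "t \<in> K" "t \<noteq> 0" "b * (b\<^sup>2 + t\<^sup>2) = - \<kappa> / \<beta>"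
      using cubic_curve_point[OF q3, of "- \<kappa> / \<beta>"] \<open>\<kappa> \<noteq> 0\<close> \<kappa> \<beta> K_closed by auto
    then show ?thesis
      using 1 by (intro bexI[of _ 0] bexI[of _ b] bexI[of _ t]) (auto intro: K_0)
  next
    case 2
    then obtain a t where "a \<in> K" "t \<in> K" "t \<noteq> 0" "a * (a\<^sup>2 + t\<^sup>2) = \<kappa> / \<alpha>"
      using cubic_curve_point[OF q3, of "\<kappa> / \<alpha>"] \<open>\<kappa> \<noteq> 0\<close> \<kappa> \<alpha> K_closed by auto
    then show ?thesis
      using 2 by (intro bexI[of _ a] bexI[of _ 0] bexI[of _ t]) (auto intro: K_0)
  next
    \<comment> \<open>On a line of direction \<open>(a, b, t) = (1, 1, -i)\<close> the cubic part vanishes; through the base point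
      \<open>(\<beta>l, \<alpha>l, 0)\<close> the quadratic part vanishes as well, so the equation becomes linear in \<open>z\<close>.\<close>
    case 3
    obtain i where i: "i \<in> K" "i\<^sup>2 = -1"
      by (rule sqrt_minus_one)
    define \<delta> where "\<delta> = \<alpha> * \<beta> * (\<beta> - \<alpha>)"
    have \<delta>: "\<delta> \<in> K" "\<delta> \<noteq> 0"
      using 3 \<alpha> \<beta> \<open>\<alpha> \<noteq> \<beta>\<close> by (auto simp: \<delta>_def intro: K_closed)
    \<comment> \<open>This keeps \<open>z\<close> below away from 0. If it failed for every
      \<open>l\<close>, comparison with \<open>l = 1\<close> would give \<open>l ^ 3 = 1\<close> for
      at least four elements.\<close>
    have "\<exists>l\<in>K - {0}. \<delta> * (\<alpha> + \<beta>) * l ^ 3 \<noteq> \<kappa>"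
    proof (rule ccontr)
      assume all: "\<not> ?thesis"
      moreover have "1 \<in> K - {0}"
        using K_1 by simp
      ultimately have "\<delta> * (\<alpha> + \<beta>) * 1 ^ 3 = \<kappa>"
        by blast
      then have "\<delta> * (\<alpha> + \<beta>) = \<kappa>"
        by simp
      with all have "K - {0} \<subseteq> {l. l ^ 3 = 1}"
        using \<open>\<kappa> \<noteq> 0\<close> by auto
      then have "card (K - {0}) \<le> 3"
        by (intro card_le_if_power_roots) auto
      then show False
        using q_ge_5 K_0 finite_K card_K by simp
    qed
    then obtain l where l: "l \<in> K" "l \<noteq> 0" "\<delta> * (\<alpha> + \<beta>) * l ^ 3 \<noteq> \<kappa>"
      by auto
    \<comment> \<open>The solution of the linear equation \<open>z3\<close> left after substituting
      the line; 3 is invertible because \<open>q mod 3 = 1\<close>.\<close>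
    define z where "z = (\<kappa> / (\<delta> * l\<^sup>2) - l * (\<alpha> + \<beta>)) / 3"
    have "3 * z = \<kappa> / (\<delta> * l\<^sup>2) - l * (\<alpha> + \<beta>)"
      by (simp only: z_def times_divide_eq_right nonzero_mult_div_cancel_left[OF three_neq_0[OF q3]])
    then have z3: "\<delta> * l\<^sup>2 * (l * (\<alpha> + \<beta>) + 3 * z) = \<kappa>"
      using \<delta> l by simp
    have "z \<noteq> 0"
      using z3 l(3) by (auto simp: power2_eq_square power3_eq_cube algebra_simps)
    moreover have "(- i * z)\<^sup>2 = - z\<^sup>2"
      using i by (simp add: power_mult_distrib)
    moreover have "\<alpha> * ((\<beta> * l + z) * ((\<beta> * l + z)\<^sup>2 + - z\<^sup>2))
        - \<beta> * ((\<alpha> * l + z) * ((\<alpha> * l + z)\<^sup>2 + - z\<^sup>2)) = \<kappa>"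
      unfolding z3[symmetric] \<delta>_def by (simp add: power2_eq_square algebra_simps)
    moreover have "z \<in> K"
      using \<alpha> \<beta> \<kappa> \<delta> l unfolding z_def by (intro K_closed)
    moreover have "i \<noteq> 0"
      using i by auto
    ultimately show ?thesis
      using \<alpha> \<beta> l i by (intro bexI[of _ "\<beta> * l + z"] bexI[of _ "\<alpha> * l + z"] bexI[of _ "- i * z"])
        (auto intro: K_closed)
  qed
qed

section \<open>Collisions of the trace polynomial\<close>

lemma collision_exists:
  fixes \<gamma> :: 'a
  assumes q2: "\<And>x :: 'a. (x ^ q) ^ q = x" and \<gamma>: "\<gamma> \<noteq> 0"
  shows "\<exists>x y. x \<noteq> y \<and> x + \<gamma> * rel_trace q (x ^ (q + 3)) = y + \<gamma> * rel_trace q (y ^ (q + 3))"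
proof -
  have dream: "(x + y) ^ q = x ^ q + y ^ q" for x y :: 'a
    using freshmans_dream'[OF CHAR_prime q_eq] by blast
  have minus: "(- x) ^ q = - (x ^ q)" for x :: 'a
    using odd_q by simp
  have diff: "(x - y) ^ q = x ^ q - y ^ q" for x y :: 'a
    using dream[of x "- y"] minus by simp
  have two: "(2 :: 'a) ^ q = 2"
    using K_numeral by (auto simp: K_eq)
  define u w where "u = (\<gamma> + \<gamma> ^ q) / 2" and "w = (\<gamma> - \<gamma> ^ q) / 2"
  have uq: "u ^ q = u" and wq: "w ^ q = - w"
    by (simp_all add: u_def w_def dream diff q2 two power_divide add.commute minus_divide_left)
  have uw: "\<gamma> = u + w"
    using two_neq_0 by (simp add: u_def w_def field_simps)
  obtain i where i: "i \<in> K" "i\<^sup>2 = -1"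
    by (rule sqrt_minus_one)
  have wK: "w = 0" if "w \<in> K"
    using that wq two_neq_0 by (simp add: K_eq eq_neg_iff_add_eq_0 flip: mult_2)
  \<comment> \<open>Equality would put \<open>w\<close> among \<plusminus>u, \<plusminus>iu, hence
    in \<open>K\<close>, where only 0 is negated by the \<open>q\<close>-th power; then
    \<open>u\<close> and \<open>\<gamma>\<close> vanish too.\<close>
  have \<alpha>\<beta>: "u ^ 4 \<noteq> w ^ 4"
  proof
    assume "u ^ 4 = w ^ 4"
    have fac: "(w - i * u) * (w + i * u) = w\<^sup>2 - i\<^sup>2 * u\<^sup>2"
      by (simp add: algebra_simps power2_eq_square)
    have "(w - u) * (w + u) * ((w - i * u) * (w + i * u)) = w ^ 4 - u ^ 4"
      unfolding fac i(2) by (simp add: algebra_simps power2_eq_square power4_eq_xxxx)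
    with \<open>u ^ 4 = w ^ 4\<close> have "(w - u) * (w + u) * ((w - i * u) * (w + i * u)) = 0"
      by simp
    then have "w = u \<or> w = - u \<or> w = i * u \<or> w = - (i * u)"
      by (auto simp: eq_neg_iff_add_eq_0)
    moreover have "u \<in> K"
      using uq by (simp add: K_eq)
    ultimately have "w \<in> K" "w = 0 \<Longrightarrow> u = 0"
      using i K_closed by auto
    then show False
      using wK uw \<gamma> by auto
  qed
  \<comment> \<open>As (a + t)^4 - (a - t)^4 = 8at(a^2 + t^2), the value -1/8 makes the traces
    differ by -2t, while the points differ by \<open>2 * t * \<gamma>\<close>.\<close>
  have \<kappa>: "- (1 / 8) \<in> K" "- (1 / 8 :: 'a) \<noteq> 0"
    using two_neq_0 power_eq_0_iff[of "2::'a" 3] by (auto intro: K_closed)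
  have "u ^ 4 \<in> K" "w ^ 4 \<in> K"
    using uq wq by (simp_all add: K_eq flip: power_mult) (simp_all add: mult.commute[of 4 q] power_mult)
  then obtain a b t where abt: "a \<in> K" "b \<in> K" "t \<in> K" "t \<noteq> 0"
    and eq: "u ^ 4 * (a * (a\<^sup>2 + t\<^sup>2)) - w ^ 4 * (b * (b\<^sup>2 + t\<^sup>2)) = - (1 / 8)"
    using cubic_surface_point[OF _ _ \<kappa>(1) \<alpha>\<beta> \<kappa>(2)] by blast
  have trace: "rel_trace q ((c * u + d * w) ^ (q + 3)) = 2 * (c ^ 4 * u ^ 4 - d ^ 4 * w ^ 4)"
    if "c \<in> K" "d \<in> K" for c d
  proof -
    \<comment> \<open>With the conjugate \<open>x'\<close>, the trace is the product of
      \<open>x * x'\<close> = c^2 u^2 - d^2 w^2 and \<open>x\<^sup>2 + x'\<^sup>2\<close> = 2(c^2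
      u^2 + d^2 w^2).\<close>
    define x where "x = c * u + d * w"
    define x' where "x' = c * u - d * w"
    have xq: "x ^ q = x'"
      using that uq wq by (simp add: x_def x'_def dream power_mult_distrib K_eq)
    have "(x ^ (q + 3)) ^ q = (x ^ q) ^ q * (x ^ q) ^ 3"
      by (simp add: power_add power_mult_distrib mult.commute flip: power_mult)
    then have "rel_trace q (x ^ (q + 3)) = x' * x ^ 3 + x * x' ^ 3"
      using xq q2[of x] by (simp add: rel_trace_def power_add)
    also have "\<dots> = 2 * (c ^ 4 * u ^ 4 - d ^ 4 * w ^ 4)"
      unfolding x_def x'_def by (simp add: power4_eq_xxxx power3_eq_cube algebra_simps)
    finally show ?thesis
      by (simp add: x_def)
  qed
  define x y where "x = (a + t) * u + (b + t) * w" and "y = (a - t) * u + (b - t) * w"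
  have xy: "x - y = 2 * t * \<gamma>"
    unfolding x_def y_def uw by (simp add: algebra_simps)
  have "rel_trace q (x ^ (q + 3)) - rel_trace q (y ^ (q + 3)) =
      2 * t * (8 * (u ^ 4 * (a * (a\<^sup>2 + t\<^sup>2)) - w ^ 4 * (b * (b\<^sup>2 + t\<^sup>2))))"
    unfolding x_def y_def using abt
    by (simp add: trace K_add K_diff) (simp add: power4_eq_xxxx power2_eq_square algebra_simps)
  also have "\<dots> = - (2 * t)"
    unfolding eq using \<kappa>(2) by simp
  finally have "\<gamma> * (rel_trace q (x ^ (q + 3)) - rel_trace q (y ^ (q + 3))) = - (x - y)"
    by (simp add: xy)
  then have "x + \<gamma> * rel_trace q (x ^ (q + 3)) = y + \<gamma> * rel_trace q (y ^ (q + 3))"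
    by (simp add: algebra_simps)
  moreover have "x \<noteq> y"
    using xy abt(4) \<gamma> two_neq_0 by auto
  ultimately show ?thesis
    by blast
qed

end

section \<open>The subfield of order \<open>q\<close>\<close>

text \<open>Root counting gives the upper bound. For the lower one, the trace maps all
  \<open>q\<^sup>2\<close> elements to fixed points, with fibres of size at most
  \<open>q\<close>.\<close>

lemma card_fixed_points_power:
  fixes q :: nat
  assumes q: "q = CHAR('a::finite_field) ^ k" and "q > 1" and card: "CARD('a) = q\<^sup>2"
  shows "card {x :: 'a. x ^ q = x} = q"
proof (rule antisym)
  have dream: "(x + y) ^ q = x ^ q + y ^ q" for x y :: 'a
    using freshmans_dream'[OF CHAR_prime q] by blast
  have roots: "card {x :: 'a. x ^ q + s * x = c} \<le> q" for s c
  proof -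
    let ?p = "monom 1 q + [:-c, s:]"
    have deg: "degree ?p = q"
      using \<open>q > 1\<close> by (subst degree_add_eq_left) (auto simp: degree_monom_eq)
    then have "?p \<noteq> 0"
      using \<open>q > 1\<close> by auto
    from card_poly_roots_bound[OF this] show ?thesis
      unfolding deg by (simp add: poly_monom algebra_simps)
  qed
  show "card {x :: 'a. x ^ q = x} \<le> q"
    using roots[of "-1" 0] by simp
  have "CARD('a) \<le> q * card (range (rel_trace q :: 'a \<Rightarrow> 'a))"
    using roots[of 1] by (intro card_le_fibre_bound) (auto simp: rel_trace_def add.commute)
  moreover have "card (range (rel_trace q :: 'a \<Rightarrow> 'a)) \<le> card {x :: 'a. x ^ q = x}"
  proof (rule card_mono)
    have "(x ^ q) ^ q = x" for x :: 'a
      using finite_field_power_card_eq_same[of x] by (simp add: card power2_eq_square power_mult)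
    then show "range (rel_trace q) \<subseteq> {x :: 'a. x ^ q = x}"
      by (auto simp: rel_trace_def dream add.commute)
  qed simp
  ultimately have "q\<^sup>2 \<le> q * card {x :: 'a. x ^ q = x}"
    using card by (metis le_trans mult_le_mono2)
  then show "q \<le> card {x :: 'a. x ^ q = x}"
    using \<open>q > 1\<close> by (simp add: power2_eq_square)
qed

theorem theorem3p4:
  fixes q :: nat and \<gamma> :: "'a::finite_field"
  assumes "primepow q" and "odd q" and "q mod 4 = 1"
    and "CARD('a) = q\<^sup>2"
  shows "permutation_poly (monom 1 1 + smult \<gamma> (rel_trace q (monom 1 (q + 3)))) \<longleftrightarrow> \<gamma> = 0"
proof -
  have f: "poly (monom 1 1 + smult \<gamma> (rel_trace q (monom 1 (q + 3)))) =
      (\<lambda>x. x + \<gamma> * rel_trace q (x ^ (q + 3)))"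
    by (rule ext) (simp add: poly_rel_trace poly_monom)
  obtain p k where p: "prime p" "k > 0" "q = p ^ k"
    using assms(1) by (auto simp: primepow_def)
  \<comment> \<open>Translation by 1 permutes the field, so the sum of all ones vanishes; this
    identifies the prime below \<open>q\<close> with the characteristic.\<close>
  have "(\<Sum>x\<in>UNIV. x + 1) = (\<Sum>x\<in>UNIV. x :: 'a)"
    by (rule sum.reindex_bij_witness[of _ "\<lambda>x. x - 1" "\<lambda>x. x + 1"]) auto
  then have "of_nat (CARD('a)) = (0 :: 'a)"
    by (simp add: sum.distrib)
  then have "CHAR('a) dvd q\<^sup>2"
    using assms(4) by (simp only: of_nat_eq_0_iff_char_dvd)
  then have "CHAR('a) dvd p"
    using prime_dvd_power[OF CHAR_prime[where 'a = 'a]] p(3) by blast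
  then have "CHAR('a) = p"
    using p(1) CHAR_prime[where 'a = 'a] primes_dvd_imp_eq by blast
  then have q: "q = CHAR('a) ^ k"
    using p by simp
  have "q > 1"
    using assms(1) by (rule primepow_gt_Suc_0[unfolded One_nat_def[symmetric]])
  interpret char_power_subfield "{x :: 'a. x ^ q = x}" q k
    using q assms card_fixed_points_power[OF q \<open>q > 1\<close> assms(4)] by unfold_locales auto
  have "(x ^ q) ^ q = x" for x :: 'a
    using finite_field_power_card_eq_same[of x] by (simp add: assms(4) power2_eq_square power_mult)
  then have "\<not> inj (\<lambda>x. x + \<gamma> * rel_trace q (x ^ (q + 3)))" if "\<gamma> \<noteq> 0"
    using collision_exists that unfolding inj_def by blast
  then show ?thesis
    unfolding permutation_poly_def f by (cases "\<gamma> = 0") (auto simp: bij_def)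
qed

end
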